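(* Let $n>2$ be an integer and let $d_1<d_2<\cdots<d_D$ be all the positive proper divisors of $n$ (the divisors other than $1$ and $n$). Then the Szeged index of the power graph of the dihedral group $\mathrm{D}_n$ of order $2n$ is $$Sz(\mathcal{P}(\mathrm{D}_n))=Sz(\mathcal{P}(\mathbb{Z}_n^* ))+\sum_{i=1}^{D}\Biggl(n+1+\sum_{\substack{1\le k\le D,\ k\ne i\\ d_k\nsim d_i}}\varphi(d_k)\Biggr)\varphi(d_i)+n\bigl(2n-1+\varphi(n)\bigr)+\varphi(n).$$
   Context: $\varphi$ is Euler's totient function. For distinct proper divisors $d_i,d_k$ of $n$, write $d_k\sim d_i$ if one of them divides the other, and $d_k\nsim d_i$ otherwise. Empty sums are $0$. The dihedral group of order $2n$ is $\mathrm{D}_n=\langle r,s: r^n=s^2=1,\ rs=sr^{-1}\rangle$. The power graph $\mathcal{P}(G)$ of a finite group $G$ is the simple undirected graph with vertex set $G$ in which two distinct elements $u,v$ are adjacent iff $u=v^m$ or $v=u^m$ for some $m\in\mathbb{N}$ (in the additive cyclic group $\mathbb{Z}_n$ of order $n$: $u=mv$ or $v=mu$). Here $\mathbb{Z}_n^*=\mathbb{Z}_n\setminus\{0\}$ (all nonzero elements, not the unit group), and $\mathcal{P}(\mathbb{Z}_n^* )$ is the graph obtained from $\mathcal{P}(\mathbb{Z}_n)$ by deleting the vertex $0$ and all edges incident to it. For an edge $ab$ of a finite simple connected graph $H$ with distance function $d$, put $n_1(ab|H)=|\{x\in V(H): d(x,a)<d(x,b)\}|$ and $n_2(ab|H)=|\{x\in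 V(H): d(x,b)<d(x,a)\}|$. The Szeged index is $Sz(H)=\sum_{ab\in E(H)} n_1(ab|H)\,n_2(ab|H)$ (each undirected edge counted once). *)

theory Defs
  imports "HOL-Algebra.Elementary_Groups" "HOL-Number_Theory.Totient"
begin

section \<open>Finite simple graphs and the Szeged index\<close>

text \<open>A graph is a pair of a vertex set and a set of two-element sets of vertices.\<close>

type_synonym 'a graph = "'a set \<times> 'a set set"

definition verts :: "'a graph \<Rightarrow> 'a set" where
  "verts H = fst H"

definition edges :: "'a graph \<Rightarrow> 'a set set" where
  "edges H = snd H"

definition delete_vertex :: "'a graph \<Rightarrow> 'a \<Rightarrow> 'a graph" where
  "delete_vertex H v = (verts H - {v}, {e \<in> edges H. v \<notin> e})"

text \<open>The length of a shortest walk; only meaningful for vertices in the same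
  connected component.\<close>

definition graph_dist :: "'a graph \<Rightarrow> 'a \<Rightarrow> 'a \<Rightarrow> nat" where
  "graph_dist H u v = (LEAST k. (u, v) \<in> {(x, y). {x, y} \<in> edges H} ^^ k)"

definition n1 :: "'a graph \<Rightarrow> 'a \<Rightarrow> 'a \<Rightarrow> nat" where
  "n1 H a b = card {x \<in> verts H. graph_dist H x a < graph_dist H x b}"

definition n2 :: "'a graph \<Rightarrow> 'a \<Rightarrow> 'a \<Rightarrow> nat" where
  "n2 H a b = card {x \<in> verts H. graph_dist H x b < graph_dist H x a}"

text \<open>The product of the two numbers does not depend on which end of the edge is called
  \<open>a\<close>, so that the definite description below is well defined and every undirected edge
  contributes once.\<close>

lemma n1_n2_commute: "n1 H a b * n2 H a b = n1 H b a * n2 H b a"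
  by (simp add: n1_def n2_def mult.commute)

definition szeged_index :: "'a graph \<Rightarrow> nat" where
  "szeged_index H =
     (\<Sum>e\<in>edges H. THE m. \<exists>a b. e = {a, b} \<and> m = n1 H a b * n2 H a b)"

lemma szeged_summand:
  "(THE m. \<exists>a b. {u, v} = {a, b} \<and> m = n1 H a b * n2 H a b) = n1 H u v * n2 H u v"
  by (rule the_equality) (auto simp: doubleton_eq_iff n1_n2_commute)


section \<open>Power graphs\<close>

definition power_graph :: "('a, 'b) monoid_scheme \<Rightarrow> 'a graph" where
  "power_graph G =
     (carrier G,
      {{u, v} | u v. u \<in> carrier G \<and> v \<in> carrier G \<and> u \<noteq> v \<and>
         (\<exists>m::nat. u = v [^]\<^bsub>G\<^esub> m \<or> v = u [^]\<^bsub>G\<^esub> m)})"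


section \<open>Groups given by generators and relations\<close>

text \<open>The generators are the elements of the type \<open>'g\<close>. The letter \<open>(x, True)\<close> stands for
  the generator \<open>x\<close> and \<open>(x, False)\<close> for its inverse. A pair \<open>(l, r)\<close> in \<open>R\<close> stands for
  the relation \<open>l = r\<close>.\<close>

type_synonym 'g word = "('g \<times> bool) list"

inductive word_eq :: "('g word \<times> 'g word) set \<Rightarrow> 'g word \<Rightarrow> 'g word \<Rightarrow> bool"
  for R where
  refl: "word_eq R u u"
| sym: "word_eq R u v \<Longrightarrow> word_eq R v u"
| trans: "word_eq R u v \<Longrightarrow> word_eq R v w \<Longrightarrow> word_eq R u w"
| cancel: "word_eq R (u @ [(x, b), (x, \<not> b)] @ v) (u @ v)"
| relation: "(l, r) \<in> R \<Longrightarrow> word_eq R (u @ l @ v) (u @ r @ v)"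

definition word_class :: "('g word \<times> 'g word) set \<Rightarrow> 'g word \<Rightarrow> 'g word set" where
  "word_class R u = {v. word_eq R u v}"

definition presented_group :: "('g word \<times> 'g word) set \<Rightarrow> 'g word set monoid" where
  "presented_group R =
     \<lparr>carrier = range (word_class R),
      monoid.mult = (\<lambda>A B. \<Union>u\<in>A. \<Union>v\<in>B. word_class R (u @ v)),
      one = word_class R []\<rparr>"

lemma word_class_eq_iff: "word_class R u = word_class R v \<longleftrightarrow> word_eq R u v"
  unfolding word_class_def by (blast intro: word_eq.refl word_eq.sym word_eq.trans)

lemma word_eq_context: "word_eq R u v \<Longrightarrow> word_eq R (a @ u @ b) (a @ v @ b)"
proof (induction rule: word_eq.induct)
  case (cancel u x c v)
  show ?case using word_eq.cancel[of R "a @ u" x c "v @ b"] by simp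
next
  case (relation l r u v)
  then show ?case using word_eq.relation[of l r R "a @ u" "v @ b"] by simp
qed (blast intro: word_eq.refl word_eq.sym word_eq.trans)+

lemma word_eq_append:
  assumes "word_eq R u u'" "word_eq R v v'"
  shows "word_eq R (u @ v) (u' @ v')"
  using word_eq_context[OF assms(1), of "[]" v] word_eq_context[OF assms(2), of u' "[]"]
  by (auto intro: word_eq.trans)

lemma presented_group_mult:
  "word_class R u \<otimes>\<^bsub>presented_group R\<^esub> word_class R v = word_class R (u @ v)"
proof -
  have "word_class R (u' @ v') = word_class R (u @ v)"
    if "u' \<in> word_class R u" "v' \<in> word_class R v" for u' v'
  proof -
    have "word_eq R (u @ v) (u' @ v')"
      using that by (intro word_eq_append) (simp_all add: word_class_def)
    then show ?thesis unfolding word_class_eq_iff by (rule word_eq.sym)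
  qed
  then have "(\<Union>u'\<in>word_class R u. \<Union>v'\<in>word_class R v. word_class R (u' @ v')) =
      (\<Union>u'\<in>word_class R u. \<Union>v'\<in>word_class R v. word_class R (u @ v))"
    by (intro SUP_cong) simp_all
  also have "\<dots> = word_class R (u @ v)"
  proof -
    have "u \<in> word_class R u" "v \<in> word_class R v"
      by (simp_all add: word_class_def word_eq.refl)
    then show ?thesis by blast
  qed
  finally show ?thesis by (simp add: presented_group_def)
qed

lemma word_eq_inverse: "word_eq R (rev (map (\<lambda>(x, b). (x, \<not> b)) u) @ u) []"
proof (induction u)
  case Nil
  show ?case by (simp add: word_eq.refl)
next
  case (Cons p u)
  obtain x b where p: "p = (x, b)" by fastforce
  show ?case
    using word_eq.cancel[of R "rev (map (\<lambda>(x, b). (x, \<not> b)) u)" x "\<not> b" u] Cons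
    by (auto simp: p intro: word_eq.trans)
qed

lemma group_presented_group: "group (presented_group R)"
proof -
  let ?G = "presented_group R"
  have one: "\<one>\<^bsub>?G\<^esub> = word_class R []"
    by (simp add: presented_group_def)
  have carrier: "carrier ?G = range (word_class R)"
    by (simp add: presented_group_def)
  have inv: "\<exists>B\<in>carrier ?G. B \<otimes>\<^bsub>?G\<^esub> word_class R u = \<one>\<^bsub>?G\<^esub>" for u
  proof (rule bexI)
    show "word_class R (rev (map (\<lambda>(x, b). (x, \<not> b)) u)) \<otimes>\<^bsub>?G\<^esub> word_class R u = \<one>\<^bsub>?G\<^esub>"
      by (simp only: one presented_group_mult word_class_eq_iff word_eq_inverse)
  qed (simp add: carrier)
  show ?thesis
    by (rule groupI) (use inv in \<open>auto simp: carrier one presented_group_mult\<close>)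
qed


section \<open>Dihedral groups\<close>

datatype dihedral_gen = Gen_r | Gen_s

text \<open>\<open>r\<^sup>n = 1\<close>, \<open>s\<^sup>2 = 1\<close> and \<open>r s = s r\<^sup>-\<^sup>1\<close>\<close>

definition dihedral_relations :: "nat \<Rightarrow> (dihedral_gen word \<times> dihedral_gen word) set" where
  "dihedral_relations n =
     {(replicate n (Gen_r, True), []),
      ([(Gen_s, True), (Gen_s, True)], []),
      ([(Gen_r, True), (Gen_s, True)], [(Gen_s, True), (Gen_r, False)])}"

definition dihedral_group :: "nat \<Rightarrow> dihedral_gen word set monoid" where
  "dihedral_group n = presented_group (dihedral_relations n)"

lemma group_dihedral_group: "group (dihedral_group n)"
  by (simp add: dihedral_group_def group_presented_group)

text \<open>The order is computed with the normal form \<open>r\<^sup>i s\<^sup>j\<close>: letters act by left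
  multiplication on the pairs \<open>(i, j)\<close>.\<close>

fun dihedral_act :: "nat \<Rightarrow> dihedral_gen \<times> bool \<Rightarrow> int \<times> bool \<Rightarrow> int \<times> bool" where
  "dihedral_act n (Gen_r, True) (i, j) = ((i + 1) mod int n, j)"
| "dihedral_act n (Gen_r, False) (i, j) = ((i - 1) mod int n, j)"
| "dihedral_act n (Gen_s, b) (i, j) = ((- i) mod int n, \<not> j)"

definition dihedral_nf :: "nat \<Rightarrow> dihedral_gen word \<Rightarrow> int \<times> bool" where
  "dihedral_nf n w = foldr (dihedral_act n) w (0, False)"

definition dihedral_word :: "int \<times> bool \<Rightarrow> dihedral_gen word" where
  "dihedral_word p =
     replicate (nat (fst p)) (Gen_r, True) @ (if snd p then [(Gen_s, True)] else [])"

lemma dihedral_act_in: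
  assumes "n > 0" shows "dihedral_act n a p \<in> {0..<int n} \<times> UNIV"
  using assms by (cases "(n, a, p)" rule: dihedral_act.cases) auto

lemma foldr_dihedral_act_in:
  assumes "n > 0" "p \<in> {0..<int n} \<times> UNIV"
  shows "foldr (dihedral_act n) w p \<in> {0..<int n} \<times> UNIV"
  using assms dihedral_act_in[OF assms(1)] by (cases w) (auto simp del: mem_Sigma_iff)

lemma dihedral_act_r_power:
  "0 \<le> i \<Longrightarrow> i < int n \<Longrightarrow>
     (dihedral_act n (Gen_r, True) ^^ k) (i, j) = ((i + int k) mod int n, j)"
proof (induction k)
  case (Suc k)
  have "((i + int k) mod int n + 1) mod int n = (i + int (Suc k)) mod int n"
    using mod_add_left_eq[of "i + int k" "int n" 1] by (simp add: ac_simps)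
  then show ?case using Suc by simp
qed simp

lemma foldr_dihedral_act_cong:
  assumes "word_eq (dihedral_relations n) u v" "n > 0" "p \<in> {0..<int n} \<times> UNIV"
  shows "foldr (dihedral_act n) u p = foldr (dihedral_act n) v p"
  using assms
proof (induction arbitrary: p rule: word_eq.induct)
  case (cancel u x b v)
  obtain i j where p: "foldr (dihedral_act n) v p = (i, j)" and i: "0 \<le> i" "i < int n"
    using foldr_dihedral_act_in[OF cancel(1,2), of v] by (auto simp del: foldr.simps)
  show ?case using i
    by (cases x; cases b) (auto simp: p mod_simps)
next
  case (relation l r u v)
  obtain i j where p: "foldr (dihedral_act n) v p = (i, j)" and i: "0 \<le> i" "i < int n"
    using foldr_dihedral_act_in[OF relation(2,3), of v] by (auto simp del: foldr.simps)
  have m1: "((- i) mod int n + 1) mod int n = (- ((i - 1) mod int n)) mod int n"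
    by (metis add.commute minus_diff_eq mod_add_left_eq mod_minus_eq uminus_add_conv_diff)
  have m2: "(- ((- i) mod int n)) mod int n = i"
    using i by (metis add.inverse_inverse mod_minus_eq mod_pos_pos_trivial)
  have "foldr (dihedral_act n) l (i, j) = foldr (dihedral_act n) r (i, j)"
    using relation(1) i dihedral_act_r_power[OF i, of n j]
    unfolding dihedral_relations_def by (elim insertE emptyE) (auto simp: m1 m2)
  then show ?case by (simp add: p)
qed auto

lemma word_eq_Cons: "word_eq R u v \<Longrightarrow> word_eq R (a # u) (a # v)"
  using word_eq_context[of R u v "[a]" "[]"] by simp

lemma dihedral_word_act:
  assumes "n > 0" "p \<in> {0..<int n} \<times> UNIV"
  shows "word_eq (dihedral_relations n) (a # dihedral_word p) (dihedral_word (dihedral_act n a p))"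
proof -
  let ?R = "dihedral_relations n"
  let ?t = "\<lambda>j. if j then [(Gen_s, True)] else []"
  note [trans] = word_eq.trans
  have rn: "word_eq ?R (replicate n (Gen_r, True) @ u) u" for u
    using word_eq.relation[of "replicate n (Gen_r, True)" "[]" ?R "[]" u]
    by (simp add: dihedral_relations_def)
  have ss: "word_eq ?R ((Gen_s, True) # (Gen_s, True) # u) u" for u
    using word_eq.relation[of "[(Gen_s, True), (Gen_s, True)]" "[]" ?R "[]" u]
    by (simp add: dihedral_relations_def)
  have rs: "word_eq ?R ((Gen_r, True) # (Gen_s, True) # u) ((Gen_s, True) # (Gen_r, False) # u)" for u
    using word_eq.relation[of "[(Gen_r, True), (Gen_s, True)]" "[(Gen_s, True), (Gen_r, False)]" ?R "[]" u]
    by (simp add: dihedral_relations_def)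
  have can: "word_eq ?R ((x, b) # (x, \<not> b) # u) u" for x b u
    using word_eq.cancel[of ?R "[]" x b u] by simp
  have can': "word_eq ?R ((x, False) # (x, True) # u) u" for x u
    using can[of x False u] by simp
  have sr: "word_eq ?R ((Gen_s, True) # (Gen_r, True) # u) ((Gen_r, False) # (Gen_s, True) # u)" for u
  proof -
    have "word_eq ?R ((Gen_s, True) # (Gen_r, True) # u)
            ((Gen_r, False) # (Gen_r, True) # (Gen_s, True) # (Gen_r, True) # u)"
      by (rule word_eq.sym, rule can')
    also have "word_eq ?R ((Gen_r, False) # (Gen_r, True) # (Gen_s, True) # (Gen_r, True) # u)
            ((Gen_r, False) # (Gen_s, True) # (Gen_r, False) # (Gen_r, True) # u)"
      by (rule word_eq_Cons, rule rs)
    also have "word_eq ?R ((Gen_r, False) # (Gen_s, True) # (Gen_r, False) # (Gen_r, True) # u)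
            ((Gen_r, False) # (Gen_s, True) # u)"
      by (rule word_eq_Cons, rule word_eq_Cons, rule can')
    finally show ?thesis .
  qed
  have r: "word_eq ?R ((Gen_r, True) # dihedral_word (i, j)) (dihedral_word ((i + 1) mod int n, j))"
    if "0 \<le> i" "i < int n" for i j
  proof (cases "i + 1 = int n")
    case True
    then have "Suc (nat i) = n" using that by linarith
    then have "(Gen_r, True) # dihedral_word (i, j) = replicate n (Gen_r, True) @ ?t j"
      by (auto simp: dihedral_word_def simp flip: replicate_Suc)
    then show ?thesis using rn[of "?t j"] True by (simp only:) (simp add: dihedral_word_def)
  next
    case False
    then have "(i + 1) mod int n = i + 1" "nat (i + 1) = Suc (nat i)" using that by auto
    then show ?thesis by (simp add: dihedral_word_def word_eq.refl)
  qed
  have r': "word_eq ?R ((Gen_r, False) # dihedral_word (i, j)) (dihedral_word ((i - 1) mod int n, j))"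
    if "0 \<le> i" "i < int n" for i j
  proof -
    have m: "0 \<le> (i - 1) mod int n" "(i - 1) mod int n < int n" using assms(1) by auto
    have "word_eq ?R ((Gen_r, True) # dihedral_word ((i - 1) mod int n, j)) (dihedral_word (i, j))"
      using r[OF m, of j] that by (simp add: mod_simps)
    from word_eq_Cons[OF word_eq.sym[OF this]]
    have "word_eq ?R ((Gen_r, False) # dihedral_word (i, j))
                 ((Gen_r, False) # (Gen_r, True) # dihedral_word ((i - 1) mod int n, j))" .
    also note can'
    finally show ?thesis .
  qed
  have s: "word_eq ?R ((Gen_s, True) # replicate k (Gen_r, True) @ ?t j)
             (dihedral_word ((- int k) mod int n, \<not> j))" for k j
  proof (induction k)
    case 0
    show ?case using ss[of "[]"] by (auto simp: dihedral_word_def word_eq.refl)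
  next
    case (Suc k)
    have m: "0 \<le> (- int k) mod int n" "(- int k) mod int n < int n" using assms(1) by auto
    have "word_eq ?R ((Gen_s, True) # replicate (Suc k) (Gen_r, True) @ ?t j)
            ((Gen_r, False) # (Gen_s, True) # replicate k (Gen_r, True) @ ?t j)"
      using sr by simp
    also have "word_eq ?R \<dots> ((Gen_r, False) # dihedral_word ((- int k) mod int n, \<not> j))"
      by (rule word_eq_Cons, rule Suc)
    also have "word_eq ?R ((Gen_r, False) # dihedral_word ((- int k) mod int n, \<not> j))
        (dihedral_word ((- int (Suc k)) mod int n, \<not> j))"
    proof -
      have "- int (Suc k) = - int k - 1" by simp
      then have e: "((- int k) mod int n - 1) mod int n = (- int (Suc k)) mod int n"
        by (simp only: mod_diff_left_eq)
      show ?thesis using r'[OF m, of "\<not> j"] unfolding e .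
    qed
    finally show ?case .
  qed
  have s1: "word_eq ?R ((Gen_s, False) # u) ((Gen_s, True) # u)" for u
  proof -
    have "word_eq ?R ((Gen_s, False) # u) ((Gen_s, False) # (Gen_s, True) # (Gen_s, True) # u)"
      by (rule word_eq_Cons, rule word_eq.sym, rule ss)
    also note can'
    finally show ?thesis .
  qed
  obtain i j where p: "p = (i, j)" and i: "0 \<le> i" "i < int n" using assms(2) by auto
  have s2: "word_eq ?R ((Gen_s, True) # dihedral_word (i, j)) (dihedral_word ((- i) mod int n, \<not> j))"
    using s[of "nat i" j] i by (simp add: dihedral_word_def)
  obtain x b where a: "a = (x, b)" by fastforce
  show ?thesis
  proof (cases x)
    case Gen_r
    then show ?thesis using r[OF i] r'[OF i] by (cases b) (simp_all add: a p)
  next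
    case Gen_s
    then show ?thesis using s2 by (cases b) (simp_all add: a p word_eq.trans[OF s1 s2])
  qed
qed

lemma word_eq_dihedral_word:
  assumes "n > 0"
  shows "word_eq (dihedral_relations n) w (dihedral_word (dihedral_nf n w))"
proof (induction w)
  case Nil
  show ?case by (simp add: dihedral_nf_def dihedral_word_def word_eq.refl)
next
  case (Cons a w)
  have "dihedral_nf n w \<in> {0..<int n} \<times> UNIV"
    unfolding dihedral_nf_def using assms by (intro foldr_dihedral_act_in) auto
  then have "word_eq (dihedral_relations n) (a # dihedral_word (dihedral_nf n w))
               (dihedral_word (dihedral_nf n (a # w)))"
    using dihedral_word_act[OF assms] by (simp add: dihedral_nf_def)
  then show ?case by (rule word_eq.trans[OF word_eq_Cons[OF Cons]])
qed

lemma dihedral_nf_dihedral_word: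
  assumes "p \<in> {0..<int n} \<times> UNIV"
  shows "dihedral_nf n (dihedral_word p) = p"
  using assms
  by (cases p) (auto simp: dihedral_nf_def dihedral_word_def dihedral_act_r_power)

lemma bij_betw_dihedral_group:
  assumes "n > 0"
  shows "bij_betw (\<lambda>p. word_class (dihedral_relations n) (dihedral_word p))
           ({0..<int n} \<times> UNIV) (carrier (dihedral_group n))"
proof (rule bij_betwI')
  fix p q :: "int \<times> bool"
  assume pq: "p \<in> {0..<int n} \<times> UNIV" "q \<in> {0..<int n} \<times> UNIV"
  have "p = q" if "word_eq (dihedral_relations n) (dihedral_word p) (dihedral_word q)"
    using foldr_dihedral_act_cong[OF that assms, of "(0, False)"] assms
      dihedral_nf_dihedral_word[OF pq(1)] dihedral_nf_dihedral_word[OF pq(2)]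
    by (simp add: dihedral_nf_def)
  then show "(word_class (dihedral_relations n) (dihedral_word p) =
         word_class (dihedral_relations n) (dihedral_word q)) = (p = q)"
    by (auto simp: word_class_eq_iff word_eq.refl)
next
  fix A assume "A \<in> carrier (dihedral_group n)"
  then obtain w where w: "A = word_class (dihedral_relations n) w"
    by (auto simp: dihedral_group_def presented_group_def)
  have "dihedral_nf n w \<in> {0..<int n} \<times> UNIV"
    unfolding dihedral_nf_def using assms by (intro foldr_dihedral_act_in) auto
  then show "\<exists>p\<in>{0..<int n} \<times> UNIV. A = word_class (dihedral_relations n) (dihedral_word p)"
    using word_eq_dihedral_word[OF assms, of w] unfolding w word_class_eq_iff
    by (intro bexI[of _ "dihedral_nf n w"])
qed (simp add: dihedral_group_def presented_group_def)

lemma order_dihedral_group: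
  assumes "n > 0" shows "order (dihedral_group n) = 2 * n"
  using bij_betw_same_card[OF bij_betw_dihedral_group[OF assms]]
  by (simp add: order_def card_cartesian_product)

end

theory Submission imports Defs begin

text \<open>The power graph of the dihedral group is the power graph of its rotation subgroup
  \<open>\<int>\<^sub>n\<close> with the \<open>n\<close> reflections attached as pendant vertices at the identity. The
  identity is adjacent to everything, so all distances are at most 2; a generator plays the same
  role in \<open>\<int>\<^sub>n\<close> without \<open>0\<close>, so an edge between nontrivial rotations contributes the same in
  both graphs. At an edge from the identity to \<open>x\<close> only \<open>x\<close> itself is closer to \<open>x\<close>, so the edge
  contributes \<open>2n - 1\<close> for a reflection and one plus the number of non-neighbours of \<open>x\<close> for a
  rotation. Rotations are adjacent iff one of their orders divides the other, and \<open>\<phi>(k)\<close> of them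
  have order \<open>k\<close>.\<close>

section \<open>Graphs with a dominating vertex\<close>

text \<open>The type of graphs admits arbitrary sets as edges, so finiteness and genuine two-element
  edges have to be demanded separately.\<close>

definition simple_graph :: "'a graph \<Rightarrow> bool" where
  "simple_graph H \<longleftrightarrow> finite (verts H) \<and>
     (\<forall>e\<in>edges H. \<exists>u v. e = {u, v} \<and> u \<noteq> v \<and> u \<in> verts H \<and> v \<in> verts H)"

definition dominating :: "'a graph \<Rightarrow> 'a \<Rightarrow> bool" where
  "dominating H c \<longleftrightarrow> c \<in> verts H \<and> (\<forall>v\<in>verts H. v \<noteq> c \<longrightarrow> {v, c} \<in> edges H)"

lemma simple_graph_edgeE:
  assumes "simple_graph H" "e \<in> edges H"
  obtains u v where "e = {u, v}" "u \<noteq> v" "u \<in> verts H" "v \<in> verts H"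
  using assms unfolding simple_graph_def by meson

lemma simple_graph_edgeD:
  assumes "simple_graph H" "{u, v} \<in> edges H"
  shows "u \<in> verts H" "v \<in> verts H" "u \<noteq> v"
proof -
  obtain a b where e: "{u, v} = {a, b}" and ab: "a \<noteq> b" "a \<in> verts H" "b \<in> verts H"
    using assms by (rule simple_graph_edgeE)
  from e have "u = a \<and> v = b \<or> u = b \<and> v = a"
    by (simp only: doubleton_eq_iff)
  with ab show "u \<in> verts H" "v \<in> verts H" "u \<noteq> v" by auto
qed

lemma finite_edges:
  assumes "simple_graph H" shows "finite (edges H)"
proof (rule finite_subset)
  show "edges H \<subseteq> Pow (verts H)" using assms by (auto elim!: simple_graph_edgeE)
  show "finite (Pow (verts H))" using assms unfolding simple_graph_def by simp
qed

text \<open>A walk through \<open>c\<close> joins any two vertices in at most two steps, so equality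
  and adjacency alone determine the distance.\<close>

lemma graph_dist_dominating:
  assumes "dominating H c" "a \<in> verts H" "b \<in> verts H"
  shows "graph_dist H a b = (if a = b then 0 else if {a, b} \<in> edges H then 1 else 2)"
proof -
  let ?R = "{(x, y). {x, y} \<in> edges H}"
  have two: "(a, b) \<in> ?R ^^ 2" if "a \<noteq> b" "{a, b} \<notin> edges H"
  proof -
    have "a \<noteq> c" "b \<noteq> c"
      using assms that by (auto simp: dominating_def insert_commute)
    then have "(a, c) \<in> ?R" "(c, b) \<in> ?R"
      using assms by (auto simp: dominating_def insert_commute)
    then show ?thesis by (auto simp: numeral_2_eq_2)
  qed
  \<comment> \<open>A walk of length 0 forces equality, and one of length 1 forces
    adjacency.\<close>
  have ge: "a \<noteq> b \<Longrightarrow> (a, b) \<in> ?R ^^ k \<Longrightarrow> 1 \<le> k"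
    "a \<noteq> b \<Longrightarrow> {a, b} \<notin> edges H \<Longrightarrow> (a, b) \<in> ?R ^^ k \<Longrightarrow> 2 \<le> k" for k
    by (cases k; cases "k - 1"; auto)+
  have "(LEAST k. (a, b) \<in> ?R ^^ k) = 0" if "a = b"
    using that by (intro Least_equality) auto
  moreover have "(LEAST k. (a, b) \<in> ?R ^^ k) = 1" if "a \<noteq> b" "{a, b} \<in> edges H"
    using that ge by (intro Least_equality) auto
  moreover have "(LEAST k. (a, b) \<in> ?R ^^ k) = 2" if "a \<noteq> b" "{a, b} \<notin> edges H"
    using that ge two by (intro Least_equality) auto
  ultimately show ?thesis by (simp add: graph_dist_def)
qed

text \<open>With distances in {0, 1, 2}, being closer to \<open>a\<close> than to \<open>b\<close>
  means distance 0 from \<open>a\<close>, or distance 1 from \<open>a\<close> and 2 from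
  \<open>b\<close>.\<close>

lemma n1_dominating:
  assumes "dominating H c" "a \<in> verts H" "b \<in> verts H" "a \<noteq> b"
  shows "n1 H a b =
    card {x \<in> verts H. x = a \<or> {x, a} \<in> edges H \<and> x \<noteq> b \<and> {x, b} \<notin> edges H}"
  unfolding n1_def
  by (rule arg_cong[where f = card])
     (use assms(2-4) in \<open>auto simp: graph_dist_dominating[OF assms(1)] split: if_splits\<close>)

lemma n2_eq_n1: "n2 H a b = n1 H b a"
  by (simp add: n1_def n2_def)

text \<open>Naming the summand of \<open>szeged_index\<close> lets the sum over edges be split and
  reindexed without touching the definite description.\<close>

definition edge_weight :: "'a graph \<Rightarrow> 'a set \<Rightarrow> nat" where
  "edge_weight H e = (THE m. \<exists>a b. e = {a, b} \<and> m = n1 H a b * n2 H a b)"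

lemma szeged_index_eq: "szeged_index H = sum (edge_weight H) (edges H)"
  by (simp add: szeged_index_def edge_weight_def)

lemma edge_weight_doubleton: "edge_weight H {a, b} = n1 H a b * n1 H b a"
  unfolding edge_weight_def szeged_summand by (simp add: n2_eq_n1)

lemma verts_delete_vertex [simp]: "verts (delete_vertex H v) = verts H - {v}"
  by (simp add: delete_vertex_def verts_def)

lemma edges_delete_vertex [simp]: "edges (delete_vertex H v) = {e \<in> edges H. v \<notin> e}"
  by (simp add: delete_vertex_def edges_def)

text \<open>\<open>H\<close> is a copy of \<open>K\<close> under \<open>h\<close> with pendant vertices \<open>F\<close> attached at \<open>h c\<close>.\<close>

locale pendant_extension =
  fixes H :: "'a graph" and K :: "'b graph" and h :: "'b \<Rightarrow> 'a" and F :: "'a set" and c g :: 'b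
  assumes simple: "simple_graph K"
    and dom: "dominating K c"
    and dom_del: "dominating (delete_vertex K c) g"
    and inj: "inj_on h (verts K)"
    and finite_F: "finite F"
    and disj: "h ` verts K \<inter> F = {}"
    and verts_H: "verts H = h ` verts K \<union> F"
    and edges_H: "edges H = (`) h ` edges K \<union> {{h c, f} | f. f \<in> F}"
begin

section \<open>Adjacency in a pendant extension\<close>

lemma c_in: "c \<in> verts K"
  using dom by (simp add: dominating_def)

lemma finite_K: "finite (verts K)"
  using simple by (simp add: simple_graph_def)

lemma edge_subset: "e \<in> edges K \<Longrightarrow> e \<subseteq> verts K"
  by (rule simple_graph_edgeE[OF simple]) auto

text \<open>A pendant edge contains a vertex outside the image of \<open>h\<close>, and injectivity
  of \<open>h\<close> recovers an edge of \<open>K\<close> from its image.\<close>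

lemma edge_h_iff:
  assumes "x \<in> verts K" "y \<in> verts K"
  shows "{h x, h y} \<in> edges H \<longleftrightarrow> {x, y} \<in> edges K"
proof -
  have "{h x, h y} \<noteq> {h c, f}" if "f \<in> F" for f
    using that disj assms by (auto simp: doubleton_eq_iff)
  moreover have "h ` {x, y} = h ` e \<longleftrightarrow> {x, y} = e" if "e \<in> edges K" for e
    using inj assms edge_subset[OF that] by (intro inj_on_image_eq_iff) auto
  ultimately show ?thesis unfolding edges_H by (auto simp: image_iff)
qed

lemma edge_F_iff:
  assumes "f \<in> F"
  shows "{f, x} \<in> edges H \<longleftrightarrow> x = h c"
proof -
  have "{f, x} \<noteq> h ` e" if "e \<in> edges K" for e
    using that disj assms edge_subset[OF that] by blast
  then show ?thesis unfolding edges_H using assms disj c_in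
    by (auto simp: image_iff doubleton_eq_iff)
qed

lemma edge_F_iff': "f \<in> F \<Longrightarrow> {x, f} \<in> edges H \<longleftrightarrow> x = h c"
  using edge_F_iff[of f x] by (simp add: insert_commute)

lemma h_eq_iff: "x \<in> verts K \<Longrightarrow> y \<in> verts K \<Longrightarrow> h x = h y \<longleftrightarrow> x = y"
  using inj by (auto simp: inj_on_def)

lemma F_neq:
  "f \<in> F \<Longrightarrow> x \<in> verts K \<Longrightarrow> f \<noteq> h x"
  "f \<in> F \<Longrightarrow> x \<in> verts K \<Longrightarrow> h x \<noteq> f"
  "x \<in> verts K \<Longrightarrow> h x \<notin> F"
  using disj by auto

lemma edge_c: "x \<in> verts K \<Longrightarrow> x \<noteq> c \<Longrightarrow> {x, c} \<in> edges K" "x \<in> verts K \<Longrightarrow> x \<noteq> c \<Longrightarrow> {c, x} \<in> edges K"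
  using dom by (simp_all add: dominating_def insert_commute[of c x])

lemma no_loop: "{x} \<notin> edges K"
  using simple_graph_edgeD(3)[OF simple, of x x] by auto

lemma dom_H: "dominating H (h c)"
  using c_in edge_F_iff by (auto simp: dominating_def verts_H edge_h_iff h_eq_iff edge_c)

lemmas adjacency = edge_h_iff edge_F_iff edge_F_iff' h_eq_iff F_neq edge_c no_loop c_in

text \<open>Neither count is affected by the vertices in which the graphs differ: \<open>h c\<close>
  has distance 1 from both ends and each pendant vertex has distance 2 from both. Distances after
  deleting \<open>c\<close> are still at most 2 because \<open>g\<close> dominates there.\<close>

lemma n1_inner:
  assumes "a \<in> verts K - {c}" "b \<in> verts K - {c}" "a \<noteq> b"
  shows "n1 H (h a) (h b) = n1 (delete_vertex K c) a b"
proof -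
  \<comment> \<open>Both counts reduce to this set, which refers only to adjacency in
    \<open>K\<close>.\<close>
  let ?B = "{x \<in> verts K - {c}. x = a \<or> {x, a} \<in> edges K \<and> x \<noteq> b \<and> {x, b} \<notin> edges K}"
  have "n1 (delete_vertex K c) a b = card ?B"
    unfolding n1_dominating[OF dom_del, simplified, OF assms[simplified]]
    by (rule arg_cong[where f = card]) (use assms in auto)
  moreover have "n1 H (h a) (h b) = card (h ` ?B)"
    using assms by (subst n1_dominating[OF dom_H]; (intro arg_cong[where f = card])?)
      (auto simp: verts_H adjacency)
  moreover have "card (h ` ?B) = card ?B"
    by (rule card_image, rule inj_on_subset[OF inj]) auto
  ultimately show ?thesis by simp
qed

text \<open>Every vertex other than \<open>h c\<close> is at distance 1 from \<open>h c\<close>, so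
  the closer ones are \<open>h c\<close> itself and those at distance 2 from \<open>h a\<close>: all
  pendant vertices and the non-neighbours of \<open>a\<close>.\<close>

lemma n1_center_left:
  assumes "a \<in> verts K - {c}"
  shows "n1 H (h c) (h a) =
    1 + card F + card {x \<in> verts K - {c}. x \<noteq> a \<and> {x, a} \<notin> edges K}" (is "_ = _ + card ?B")
proof -
  have "n1 H (h c) (h a) = card ({h c} \<union> F \<union> h ` ?B)"
    using assms by (subst n1_dominating[OF dom_H]; (intro arg_cong[where f = card])?)
      (auto simp: verts_H adjacency)
  also have "\<dots> = card ({h c} \<union> F) + card (h ` ?B)"
    using finite_F finite_K by (intro card_Un_disjoint) (auto simp: adjacency)
  also have "card (h ` ?B) = card ?B"
    by (rule card_image, rule inj_on_subset[OF inj]) auto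
  also have "card ({h c} \<union> F) = 1 + card F"
    using finite_F F_neq(3)[OF c_in] by simp
  finally show ?thesis .
qed

text \<open>No vertex is farther than 1 from \<open>h c\<close>, so being closer to \<open>a\<close>
  means distance 0 from \<open>a\<close>.\<close>

lemma n1_center_right:
  assumes "a \<in> verts H" "a \<noteq> h c"
  shows "n1 H a (h c) = 1"
proof -
  have "{x, h c} \<in> edges H" if "x \<in> verts H" "x \<noteq> h c" for x
    using that dom_H by (simp add: dominating_def)
  then have "n1 H a (h c) = card {a}"
    using assms c_in by (subst n1_dominating[OF dom_H]; (intro arg_cong[where f = card])?)
      (auto simp: verts_H)
  then show ?thesis by simp
qed

text \<open>The only neighbour of \<open>f\<close> is \<open>h c\<close>, so every vertex except
  \<open>f\<close> is closer to \<open>h c\<close>.\<close>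

lemma n1_pendant:
  assumes "f \<in> F"
  shows "n1 H (h c) f = card (verts K) + card F - 1"
proof -
  have "n1 H (h c) f = card (verts H - {f})"
    using assms by (subst n1_dominating[OF dom_H]; (intro arg_cong[where f = card])?)
      (auto simp: verts_H adjacency)
  also have "\<dots> = card (verts H) - 1"
    using assms finite_K finite_F by (simp add: verts_H)
  also have "card (verts H) = card (h ` verts K) + card F"
    unfolding verts_H using finite_K finite_F disj by (intro card_Un_disjoint) auto
  also have "card (h ` verts K) = card (verts K)"
    by (rule card_image[OF inj])
  finally show ?thesis .
qed

text \<open>The edges of \<open>H\<close> fall into three classes: images of edges avoiding
  \<open>c\<close>, images of edges at \<open>c\<close>, and pendant edges. In the last two classes
  one factor of the weight is 1, by \<open>n1_center_right\<close>.\<close>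

lemma szeged_index_pendant_extension:
  "szeged_index H = szeged_index (delete_vertex K c)
     + (\<Sum>a\<in>verts K - {c}. 1 + card F + card {x \<in> verts K - {c}. x \<noteq> a \<and> {x, a} \<notin> edges K})
     + card F * (card (verts K) + card F - 1)"
proof -
  let ?w = "edge_weight H"
  let ?E = "{e \<in> edges K. c \<notin> e}" and ?C = "(\<lambda>a. {c, a}) ` (verts K - {c})"
  let ?P = "(\<lambda>f. {h c, f}) ` F"
  \<comment> \<open>Since \<open>c\<close> dominates \<open>K\<close>, the edges through
    \<open>c\<close> correspond exactly to the other vertices.\<close>
  have EC: "edges K = ?E \<union> ?C"
  proof
    show "edges K \<subseteq> ?E \<union> ?C"
    proof
      fix e assume "e \<in> edges K"
      with simple show "e \<in> ?E \<union> ?C"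
        by (elim simple_graph_edgeE) (use \<open>e \<in> edges K\<close> in auto)
    qed
  qed (use edge_c(2) in auto)
  have inj_image: "inj_on ((`) h) (edges K)"
    using inj edge_subset by (intro inj_onI) (simp add: inj_on_image_eq_iff)
  have "edges H = (`) h ` edges K \<union> ?P"
    unfolding edges_H by auto
  moreover have "(`) h ` edges K \<inter> ?P = {}"
    using edge_subset disj by blast
  ultimately have "szeged_index H = sum ?w ((`) h ` edges K) + sum ?w ?P"
    using finite_edges[OF simple] finite_F by (simp add: szeged_index_eq sum.union_disjoint)
  also have "sum ?w ((`) h ` edges K) = (\<Sum>e\<in>edges K. ?w (h ` e))"
    using sum.reindex[OF inj_image] by simp
  also have "\<dots> = (\<Sum>e\<in>?E. ?w (h ` e)) + (\<Sum>e\<in>?C. ?w (h ` e))"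
    using finite_edges[OF simple] finite_K by (subst EC, intro sum.union_disjoint) auto
  also have "(\<Sum>e\<in>?E. ?w (h ` e)) = szeged_index (delete_vertex K c)"
    unfolding szeged_index_eq
  proof (rule sum.cong)
    fix e assume "e \<in> edges (delete_vertex K c)"
    then have "e \<in> edges K" "c \<notin> e" by simp_all
    then obtain a b where e: "e = {a, b}" "a \<noteq> b" "a \<in> verts K - {c}" "b \<in> verts K - {c}"
      using simple by (elim simple_graph_edgeE) auto
    show "?w (h ` e) = edge_weight (delete_vertex K c) e"
      using e by (simp add: edge_weight_doubleton n1_inner)
  qed simp
  also have "(\<Sum>e\<in>?C. ?w (h ` e)) = (\<Sum>a\<in>verts K - {c}. ?w {h c, h a})"
    by (subst sum.reindex) (auto simp: inj_on_def doubleton_eq_iff)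
  also have "\<dots> = (\<Sum>a\<in>verts K - {c}. 1 + card F
      + card {x \<in> verts K - {c}. x \<noteq> a \<and> {x, a} \<notin> edges K})"
  proof (rule sum.cong)
    fix a assume a: "a \<in> verts K - {c}"
    then have "n1 H (h a) (h c) = 1"
      by (intro n1_center_right) (auto simp: verts_H h_eq_iff c_in)
    then show "?w {h c, h a} =
        1 + card F + card {x \<in> verts K - {c}. x \<noteq> a \<and> {x, a} \<notin> edges K}"
      unfolding edge_weight_doubleton n1_center_left[OF a] by simp
  qed simp
  also have "sum ?w ?P = (\<Sum>f\<in>F. ?w {h c, f})"
    using F_neq(1)[OF _ c_in] by (subst sum.reindex) (auto simp: inj_on_def doubleton_eq_iff)
  also have "\<dots> = (\<Sum>f\<in>F. card (verts K) + card F - 1)"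
  proof (rule sum.cong)
    fix f assume f: "f \<in> F"
    then have "n1 H f (h c) = 1"
      using F_neq(1)[OF f c_in] by (intro n1_center_right) (auto simp: verts_H)
    then show "?w {h c, f} = card (verts K) + card F - 1"
      unfolding edge_weight_doubleton n1_pendant[OF f] by simp
  qed simp
  finally show ?thesis by simp
qed

end

section \<open>Power graphs\<close>

lemma verts_power_graph [simp]: "verts (power_graph G) = carrier G"
  by (simp add: power_graph_def verts_def)

lemma edges_power_graph:
  "edges (power_graph G) =
     {{u, v} | u v. u \<in> carrier G \<and> v \<in> carrier G \<and> u \<noteq> v \<and>
        (\<exists>m::nat. u = v [^]\<^bsub>G\<^esub> m \<or> v = u [^]\<^bsub>G\<^esub> m)}"
  by (simp add: power_graph_def edges_def)

text \<open>The adjacency condition is symmetric, so it does not matter which of the two orderings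
  of the edge is chosen.\<close>

lemma edge_power_graph_iff:
  "{u, v} \<in> edges (power_graph G) \<longleftrightarrow>
     u \<in> carrier G \<and> v \<in> carrier G \<and> u \<noteq> v \<and>
     (\<exists>m::nat. u = v [^]\<^bsub>G\<^esub> m \<or> v = u [^]\<^bsub>G\<^esub> m)"
proof -
  have "(\<exists>a b. {u, v} = {a, b} \<and> P a b) \<longleftrightarrow> P u v \<or> P v u" for P
    by (auto simp: doubleton_eq_iff)
  from this[of "\<lambda>u v. u \<in> carrier G \<and> v \<in> carrier G \<and> u \<noteq> v \<and>
        (\<exists>m::nat. u = v [^]\<^bsub>G\<^esub> m \<or> v = u [^]\<^bsub>G\<^esub> m)"]
  show ?thesis unfolding edges_power_graph mem_Collect_eq by metis
qed

lemma simple_graph_power_graph: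
  "finite (carrier G) \<Longrightarrow> simple_graph (power_graph G)"
  unfolding simple_graph_def verts_power_graph edges_power_graph by auto

text \<open>The exponent 0 is allowed, so the identity is a power of every element.\<close>

lemma dominating_one_power_graph:
  assumes "group G" shows "dominating (power_graph G) \<one>\<^bsub>G\<^esub>"
proof -
  interpret group G by fact
  have "\<exists>m::nat. \<one>\<^bsub>G\<^esub> = v [^]\<^bsub>G\<^esub> m" for v
    by (rule exI[of _ 0]) simp
  then show ?thesis unfolding dominating_def edge_power_graph_iff by auto
qed

section \<open>Adjoining involutions to a group\<close>

lemma nat_pow_involution:
  assumes "group G" "f \<in> carrier G" "f \<otimes>\<^bsub>G\<^esub> f = \<one>\<^bsub>G\<^esub>"
  shows "f [^]\<^bsub>G\<^esub> (m::nat) \<in> {\<one>\<^bsub>G\<^esub>, f}"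
proof -
  interpret group G by fact
  show ?thesis using assms(2,3) by (induction m) auto
qed

text \<open>A power of an element of the image of \<open>h\<close> stays in that image, and an
  element of \<open>F\<close> has only itself and the identity as powers. So the only new edges join
  \<open>F\<close> to the identity, which \<open>disj\<close> keeps out of \<open>F\<close>.\<close>

lemma edges_power_graph_extension:
  assumes K: "group K" and G: "group G"
    and h: "h \<in> hom K G" and inj: "inj_on h (carrier K)"
    and carrier: "carrier G = h ` carrier K \<union> F" and disj: "h ` carrier K \<inter> F = {}"
    and F: "\<And>f. f \<in> F \<Longrightarrow> f \<otimes>\<^bsub>G\<^esub> f = \<one>\<^bsub>G\<^esub>"
  shows "edges (power_graph G) = (`) h ` edges (power_graph K) \<union> {{h \<one>\<^bsub>K\<^esub>, f} | f. f \<in> F}"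
    (is "?L = ?R")
proof
  interpret K: group K by fact
  interpret G: group G by fact
  have h_one: "h \<one>\<^bsub>K\<^esub> = \<one>\<^bsub>G\<^esub>" using h K G by (rule hom_one)
  have h_in: "h x \<in> carrier G" if "x \<in> carrier K" for x using that carrier by auto
  have pow: "h (x [^]\<^bsub>K\<^esub> (m::nat)) = h x [^]\<^bsub>G\<^esub> m" if "x \<in> carrier K" for x m
    by (rule hom_nat_pow[OF h that K G])
  \<comment> \<open>One direction of the power relation suffices; the other follows by exchanging
    the ends of the edge.\<close>
  have key: "{u, v} \<in> ?R"
    if u: "u \<in> carrier G" and uv: "v \<noteq> u" and v: "v = u [^]\<^bsub>G\<^esub> (m::nat)" for u v m
  proof (cases "u \<in> F")
    case True
    then have "v = h \<one>\<^bsub>K\<^esub>" using nat_pow_involution[OF G u F] uv v h_one by auto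
    then show ?thesis using True by (auto simp: insert_commute)
  next
    case False
    then obtain x where x: "x \<in> carrier K" "u = h x" using u carrier by auto
    then have "v = h (x [^]\<^bsub>K\<^esub> m)" "x [^]\<^bsub>K\<^esub> m \<in> carrier K" using v pow by auto
    moreover have "x \<noteq> x [^]\<^bsub>K\<^esub> m" using uv x calculation by auto
    ultimately have "{u, v} = h ` {x, x [^]\<^bsub>K\<^esub> m}" "{x, x [^]\<^bsub>K\<^esub> m} \<in> edges (power_graph K)"
      using x by (auto simp: edge_power_graph_iff)
    then show ?thesis by blast
  qed
  show "?L \<subseteq> ?R"
  proof
    fix e assume "e \<in> ?L"
    then obtain u v and m :: nat where e: "e = {u, v}" "u \<in> carrier G" "v \<in> carrier G" "u \<noteq> v"
      and m: "u = v [^]\<^bsub>G\<^esub> m \<or> v = u [^]\<^bsub>G\<^esub> m"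
      unfolding edges_power_graph by auto
    from m show "e \<in> ?R"
    proof
      assume "u = v [^]\<^bsub>G\<^esub> m"
      from key[OF e(3) e(4) this] show ?thesis unfolding e(1) by (simp only: insert_commute)
    next
      assume "v = u [^]\<^bsub>G\<^esub> m"
      from key[OF e(2) e(4)[symmetric] this] show ?thesis unfolding e(1) .
    qed
  qed
  show "?R \<subseteq> ?L"
  proof
    fix e assume "e \<in> ?R"
    then show "e \<in> ?L"
    proof
      assume "e \<in> (`) h ` edges (power_graph K)"
      then obtain u v and m :: nat where e: "e = {h u, h v}" and uv: "u \<in> carrier K" "v \<in> carrier K" "u \<noteq> v"
        and m: "u = v [^]\<^bsub>K\<^esub> m \<or> v = u [^]\<^bsub>K\<^esub> m"
        unfolding edges_power_graph by auto
      have "h u \<noteq> h v" using inj uv by (auto simp: inj_on_def)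
      moreover have "h u = h v [^]\<^bsub>G\<^esub> m \<or> h v = h u [^]\<^bsub>G\<^esub> m" using m pow uv by metis
      ultimately show ?thesis unfolding e edge_power_graph_iff using uv h_in by blast
    next
      assume "e \<in> {{h \<one>\<^bsub>K\<^esub>, f} | f. f \<in> F}"
      then obtain f where f: "f \<in> F" and e: "e = {h \<one>\<^bsub>K\<^esub>, f}" by blast
      have "h \<one>\<^bsub>K\<^esub> = f [^]\<^bsub>G\<^esub> (0::nat)" by (simp add: h_one)
      moreover have "h \<one>\<^bsub>K\<^esub> \<noteq> f" using f disj by auto
      ultimately show ?thesis unfolding e edge_power_graph_iff using f carrier by blast
    qed
  qed
qed

section \<open>Rotations and reflections\<close>

text \<open>The element r^i, given by its normal form. It is meant for \<open>i\<close> in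
  \<open>{0..<int n}\<close>, as \<open>dihedral_word\<close> reads a negative exponent as
  0.\<close>

definition rotation :: "nat \<Rightarrow> int \<Rightarrow> dihedral_gen word set" where
  "rotation n i = word_class (dihedral_relations n) (dihedral_word (i, False))"

definition reflection :: "nat \<Rightarrow> int \<Rightarrow> dihedral_gen word set" where
  "reflection n i = word_class (dihedral_relations n) (dihedral_word (i, True))"

lemma foldr_dihedral_act_replicate:
  assumes "0 \<le> i" "i < int n"
  shows "foldr (dihedral_act n) (replicate k (Gen_r, True)) (i, j) = ((i + int k) mod int n, j)"
  using dihedral_act_r_power[OF assms] by simp

text \<open>Products in the presented group can thus be evaluated by computing normal forms of
  concatenated words.\<close>

lemma word_class_dihedral_nf:
  "n > 0 \<Longrightarrow> word_class (dihedral_relations n) w =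
     word_class (dihedral_relations n) (dihedral_word (dihedral_nf n w))"
  by (simp add: word_class_eq_iff word_eq_dihedral_word)

lemma rotation_hom:
  assumes "n > 0"
  shows "rotation n \<in> hom (integer_mod_group n) (dihedral_group n)"
proof (rule homI)
  fix i j assume "i \<in> carrier (integer_mod_group n)" "j \<in> carrier (integer_mod_group n)"
  then have ij: "0 \<le> i" "i < int n" "0 \<le> j" "j < int n"
    using assms by (auto simp: carrier_integer_mod_group)
  have "dihedral_nf n (dihedral_word (i, False) @ dihedral_word (j, False)) = ((i + j) mod int n, False)"
    using ij by (simp add: dihedral_nf_def dihedral_word_def foldr_dihedral_act_replicate dihedral_act_r_power add.commute)
  then show "rotation n (i \<otimes>\<^bsub>integer_mod_group n\<^esub> j) =
      rotation n i \<otimes>\<^bsub>dihedral_group n\<^esub> rotation n j"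
    using word_class_dihedral_nf[OF assms, of "dihedral_word (i, False) @ dihedral_word (j, False)"]
    by (simp add: rotation_def dihedral_group_def presented_group_mult)
qed (simp add: rotation_def dihedral_group_def presented_group_def)

text \<open>The letters of r^i s r^i s act from the right: the pair (0, False) becomes (0, True),
  (i, True), (-i mod n, False) and finally (0, False).\<close>

lemma reflection_square:
  assumes "0 \<le> i" "i < int n"
  shows "reflection n i \<otimes>\<^bsub>dihedral_group n\<^esub> reflection n i = \<one>\<^bsub>dihedral_group n\<^esub>"
proof -
  have n: "n > 0" using assms by simp
  have "dihedral_nf n (dihedral_word (i, True) @ dihedral_word (i, True)) = (0, False)"
    using assms n
    by (simp add: dihedral_nf_def dihedral_word_def foldr_dihedral_act_replicate dihedral_act_r_power mod_simps)
  moreover have "dihedral_word (0, False) = []" by (simp add: dihedral_word_def)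
  ultimately show ?thesis
    using word_class_dihedral_nf[OF n, of "dihedral_word (i, True) @ dihedral_word (i, True)"]
    by (simp add: reflection_def dihedral_group_def presented_group_mult) (simp add: presented_group_def)
qed

text \<open>The bijection with pairs (i, j) is split according to the Boolean coordinate.\<close>

lemma dihedral_group_decomposition:
  assumes "n > 0"
  shows "inj_on (rotation n) {0..<int n}" "inj_on (reflection n) {0..<int n}"
    and "rotation n ` {0..<int n} \<inter> reflection n ` {0..<int n} = {}"
    and "carrier (dihedral_group n) = rotation n ` {0..<int n} \<union> reflection n ` {0..<int n}"
proof -
  let ?f = "\<lambda>p. word_class (dihedral_relations n) (dihedral_word p)"
  have f: "inj_on ?f ({0..<int n} \<times> UNIV)" "?f ` ({0..<int n} \<times> UNIV) = carrier (dihedral_group n)"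
    using bij_betw_dihedral_group[OF assms] by (simp_all add: bij_betw_def)
  have eq: "?f (i, b) = ?f (j, b') \<longleftrightarrow> i = j \<and> b = b'" if "i \<in> {0..<int n}" "j \<in> {0..<int n}" for i j b b'
    using inj_on_eq_iff[OF f(1), of "(i, b)" "(j, b')"] that by simp
  show "inj_on (rotation n) {0..<int n}" "inj_on (reflection n) {0..<int n}"
    "rotation n ` {0..<int n} \<inter> reflection n ` {0..<int n} = {}"
    unfolding rotation_def reflection_def inj_on_def using eq by blast+
  have "{0..<int n} \<times> UNIV = (\<lambda>i. (i, False)) ` {0..<int n} \<union> (\<lambda>i. (i, True)) ` {0..<int n}"
    by (auto simp: image_iff)
  then show "carrier (dihedral_group n) = rotation n ` {0..<int n} \<union> reflection n ` {0..<int n}"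
    unfolding f(2)[symmetric] by (simp add: image_Un image_image rotation_def reflection_def)
qed

section \<open>Orders in the cyclic group\<close>

text \<open>For \<open>n > 0\<close> this is the additive order of \<open>x\<close> modulo
  \<open>n\<close>, in closed form; it is 1 at 0.\<close>

definition cyclic_order :: "nat \<Rightarrow> int \<Rightarrow> nat" where
  "cyclic_order n x = n div nat (gcd x (int n))"

lemma cyclic_order_mult_gcd: "int (cyclic_order n x) * gcd x (int n) = int n"
proof -
  have "nat (gcd x (int n)) dvd n" by (simp add: nat_dvd_iff)
  then have "cyclic_order n x * nat (gcd x (int n)) = n"
    by (simp add: cyclic_order_def)
  from arg_cong[OF this, of int] show ?thesis by simp
qed

text \<open>The orders are n/u and n/v for the two gcds u and v, so divisibility of the orders
  reverses to v dividing u. As v already divides n, this says that v divides x.\<close>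

lemma cyclic_order_dvd_iff:
  assumes "n > 0"
  shows "cyclic_order n x dvd cyclic_order n y \<longleftrightarrow> gcd y (int n) dvd x"
proof -
  let ?u = "gcd x (int n)" and ?v = "gcd y (int n)"
  let ?p = "int (cyclic_order n x)" and ?q = "int (cyclic_order n y)"
  have u: "?p * ?u = int n" and v: "?q * ?v = int n"
    by (rule cyclic_order_mult_gcd)+
  have nz: "?p \<noteq> 0" "?q \<noteq> 0" "?u \<noteq> 0" "?v \<noteq> 0"
    using mult_eq_0_iff[of ?p ?u] mult_eq_0_iff[of ?q ?v] assms unfolding u v by auto
  have "?p dvd ?q \<longleftrightarrow> ?p * ?u dvd ?q * ?u" by (simp only: dvd_mult_cancel_right nz simp_thms)
  also have "\<dots> \<longleftrightarrow> ?q * ?v dvd ?q * ?u" by (simp add: u v)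
  also have "\<dots> \<longleftrightarrow> ?v dvd ?u" by (simp only: dvd_mult_cancel_left nz simp_thms)
  also have "\<dots> \<longleftrightarrow> ?v dvd x" by simp
  finally show ?thesis by simp
qed

text \<open>By Bezout, some multiple of \<open>y\<close> is congruent to the gcd, and scaling it
  reaches every multiple of the gcd.\<close>

lemma multiple_mod_iff_gcd_dvd:
  assumes "0 \<le> x" "x < int n"
  shows "(\<exists>m::nat. x = int m * y mod int n) \<longleftrightarrow> gcd y (int n) dvd x"
proof
  assume "\<exists>m::nat. x = int m * y mod int n"
  then show "gcd y (int n) dvd x" by (auto simp: dvd_mod_iff)
next
  assume "gcd y (int n) dvd x"
  then obtain k where k: "x = gcd y (int n) * k" by blast
  obtain z where "[y * z = gcd y (int n)] (mod int n)"
    using cong_solve_int by blast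
  then have "[y * z * k = x] (mod int n)" unfolding k by (rule cong_mult) simp
  then have "y * z * k mod int n = x" using assms by (simp add: cong_def)
  \<comment> \<open>The Bezout multiplier may be negative; reduction modulo \<open>n\<close> makes
    it a natural number.\<close>
  moreover have "int (nat (z * k mod int n)) * y mod int n = y * z * k mod int n"
    using assms by (simp add: mod_simps ac_simps)
  ultimately show "\<exists>m::nat. x = int m * y mod int n" by metis
qed

lemma edge_power_graph_integer_mod_group_iff:
  assumes "x \<in> {0..<int n}" "y \<in> {0..<int n}"
  shows "{x, y} \<in> edges (power_graph (integer_mod_group n)) \<longleftrightarrow>
    x \<noteq> y \<and> (cyclic_order n x dvd cyclic_order n y \<or> cyclic_order n y dvd cyclic_order n x)"
proof -
  have n: "n > 0" using assms by auto
  have "(\<exists>m::nat. x = int m * y mod int n \<or> y = int m * x mod int n) \<longleftrightarrow>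
      gcd y (int n) dvd x \<or> gcd x (int n) dvd y"
    unfolding ex_disj_distrib using assms by (simp add: multiple_mod_iff_gcd_dvd)
  then show ?thesis
    using n assms by (simp add: edge_power_graph_iff carrier_integer_mod_group cyclic_order_dvd_iff)
qed

section \<open>Counting residues by their order\<close>

lemma cyclic_order_dvd: "cyclic_order n x dvd n"
  using cyclic_order_mult_gcd[of n x] by (metis dvd_triv_left of_nat_dvd_iff)

text \<open>Order \<open>k\<close> means gcd n/k with \<open>n\<close>, and
  \<open>card_gcd_eq_totient\<close> counts such residues. The case k = 1 is left out because 0 is
  not in the range.\<close>

lemma card_cyclic_order:
  assumes n: "n > 0" and k: "k dvd n" "k \<noteq> 1"
  shows "card {x \<in> {0<..<int n}. cyclic_order n x = k} = totient k"
proof -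
  obtain l where l: "n = k * l" using k by blast
  have pos: "k > 0" "l > 0" using n l by auto
  have "n div l = k" using l pos by simp
  have eq: "cyclic_order n (int j) = k \<longleftrightarrow> gcd j n = l" for j
  proof -
    have "int (cyclic_order n (int j) * gcd j n) = int n"
      using cyclic_order_mult_gcd[of n "int j"] by simp
    then have "cyclic_order n (int j) * gcd j n = k * l" using l by (simp only: of_nat_eq_iff)
    then show ?thesis using pos by auto
  qed
  have "{x \<in> {0<..<int n}. cyclic_order n x = k} = int ` {j \<in> {0<..n}. gcd j n = l}"
  proof (intro equalityI subsetI)
    fix x assume x: "x \<in> {x \<in> {0<..<int n}. cyclic_order n x = k}"
    then have "x = int (nat x)" by simp
    with x eq[of "nat x"] show "x \<in> int ` {j \<in> {0<..n}. gcd j n = l}"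
      by (intro image_eqI[of _ _ "nat x"]) auto
  next
    fix x assume "x \<in> int ` {j \<in> {0<..n}. gcd j n = l}"
    then obtain j where j: "x = int j" "0 < j" "j \<le> n" "gcd j n = l" by auto
    \<comment> \<open>The library count includes the endpoint \<open>n\<close>, whose gcd with
      \<open>n\<close> would force k = 1.\<close>
    have "j \<noteq> n" using j(4) l k(2) pos by auto
    with j eq[of j] show "x \<in> {x \<in> {0<..<int n}. cyclic_order n x = k}" by auto
  qed
  then have "card {x \<in> {0<..<int n}. cyclic_order n x = k} = card {j \<in> {0<..n}. gcd j n = l}"
    by (simp add: card_image)
  also have "\<dots> = totient k"
    using card_gcd_eq_totient[OF n, of l] l \<open>n div l = k\<close> by simp
  finally show ?thesis .
qed

lemma cyclic_order_neq_1:
  assumes "x \<in> {0<..<int n}" shows "cyclic_order n x \<noteq> 1"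
proof
  assume "cyclic_order n x = 1"
  then have "gcd x (int n) = int n" using cyclic_order_mult_gcd[of n x] by simp
  then have "int n dvd x" by (metis gcd_dvd1)
  with assms show False by (auto dest: zdvd_imp_le)
qed

text \<open>The nonzero residues are grouped by order; the fibre over \<open>k\<close> has
  \<open>totient k\<close> elements.\<close>

lemma sum_cyclic_order:
  fixes f :: "nat \<Rightarrow> nat"
  assumes "n > 0"
  shows "(\<Sum>x\<in>{0<..<int n}. f (cyclic_order n x)) = (\<Sum>k | k dvd n \<and> k \<noteq> 1. f k * totient k)"
proof -
  let ?A = "{0<..<int n}" and ?D = "{k. k dvd n \<and> k \<noteq> 1}"
  have "(\<Sum>x\<in>?A. f (cyclic_order n x)) =
      (\<Sum>k\<in>?D. \<Sum>x | x \<in> ?A \<and> cyclic_order n x = k. f (cyclic_order n x))"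
    using assms cyclic_order_dvd cyclic_order_neq_1 by (intro sum.group[symmetric]) auto
  also have "\<dots> = (\<Sum>k\<in>?D. f k * totient k)"
  proof (rule sum.cong)
    fix k assume "k \<in> ?D"
    then have "totient k = card {x \<in> ?A. cyclic_order n x = k}"
      using card_cyclic_order[OF assms] by simp
    then show "(\<Sum>x | x \<in> ?A \<and> cyclic_order n x = k. f (cyclic_order n x)) = f k * totient k"
      by simp
  qed simp
  finally show ?thesis .
qed

text \<open>Non-adjacency to \<open>a\<close> depends only on the order of \<open>x\<close>, and
  \<open>x \<noteq> a\<close> is automatic once the orders are incomparable.\<close>

lemma card_incomparable_cyclic_order:
  assumes "n > 0" "a \<in> {0<..<int n}"
  shows "card {x \<in> {0<..<int n}. x \<noteq> a \<and> {x, a} \<notin> edges (power_graph (integer_mod_group n))} =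
    (\<Sum>k | k dvd n \<and> k \<noteq> 1 \<and> \<not> (k dvd cyclic_order n a \<or> cyclic_order n a dvd k). totient k)"
    (is "card ?B = sum _ ?K")
proof -
  let ?A = "{0<..<int n}" and ?P = "\<lambda>k. \<not> (k dvd cyclic_order n a \<or> cyclic_order n a dvd k)"
  have "?B = {x \<in> ?A. ?P (cyclic_order n x)}"
    using assms by (auto simp: edge_power_graph_integer_mod_group_iff)
  \<comment> \<open>As a sum of indicators the cardinality becomes an instance of
    \<open>sum_cyclic_order\<close>.\<close>
  then have "card ?B = (\<Sum>x\<in>?A. of_bool (?P (cyclic_order n x)))"
    by (simp add: Int_def)
  also have "\<dots> = (\<Sum>k | k dvd n \<and> k \<noteq> 1. of_bool (?P k) * totient k)"
    by (rule sum_cyclic_order[OF assms(1)])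
  also have "\<dots> = sum totient ?K"
    using assms(1) by (intro sum.mono_neutral_cong_right) auto
  finally show ?thesis .
qed

section \<open>The dihedral power graph\<close>

theorem theorem3p3:
  fixes n D :: nat and d :: "nat \<Rightarrow> nat"
  assumes "n > 2"
    and "strict_mono_on {1..D} d"
    and "d ` {1..D} = {k. k dvd n \<and> k \<noteq> 1 \<and> k \<noteq> n}"
  shows "szeged_index (power_graph (dihedral_group n)) =
           szeged_index (delete_vertex (power_graph (integer_mod_group n)) 0)
           + (\<Sum>i = 1..D.
                (n + 1
                 + (\<Sum>k | k \<in> {1..D} \<and> k \<noteq> i \<and> \<not> (d k dvd d i \<or> d i dvd d k).
                      totient (d k)))
                * totient (d i))
           + n * (2 * n - 1 + totient n)
           + totient n"
proof -
  let ?K = "power_graph (integer_mod_group n)" and ?H = "power_graph (dihedral_group n)"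
  let ?F = "reflection n ` {0..<int n}" and ?A = "{0<..<int n}"
  have n: "n > 0" using assms(1) by simp
  have carrier: "carrier (integer_mod_group n) = {0..<int n}"
    using n by (simp add: carrier_integer_mod_group)
  have A: "verts ?K - {0} = ?A" by (auto simp: carrier)
  note dec = dihedral_group_decomposition[OF n]
  \<comment> \<open>The residue 1 has order \<open>n\<close>, which every order divides, so it
    dominates once 0 is deleted.\<close>
  have one: "{v, 1} \<in> edges ?K" if "v \<in> ?A" "v \<noteq> 1" for v
  proof -
    have "cyclic_order n 1 = n" by (simp add: cyclic_order_def)
    with that assms(1) show ?thesis
      by (simp add: edge_power_graph_integer_mod_group_iff cyclic_order_dvd)
  qed
  have edges: "edges ?H = (`) (rotation n) ` edges ?K \<union> {{rotation n 0, f} | f. f \<in> ?F}"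
  proof (rule edges_power_graph_extension[where K = "integer_mod_group n", unfolded one_integer_mod_group])
    show "f \<otimes>\<^bsub>dihedral_group n\<^esub> f = \<one>\<^bsub>dihedral_group n\<^esub>" if "f \<in> ?F" for f
      using that reflection_square by (elim imageE) simp
  qed (use dec rotation_hom[OF n] in \<open>simp_all only: carrier group_integer_mod_group group_dihedral_group\<close>)
  interpret pendant_extension ?H ?K "rotation n" ?F 0 1
  proof
    show "simple_graph ?K" by (rule simple_graph_power_graph) (simp add: carrier)
    show "dominating ?K 0"
      using dominating_one_power_graph[OF group_integer_mod_group[of n]] by simp
    show "dominating (delete_vertex ?K 0) 1"
      unfolding dominating_def using one assms(1) A by auto
    show "edges ?H = (`) (rotation n) ` edges ?K \<union> {{rotation n 0, f} | f. f \<in> ?F}"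
      by (rule edges)
  qed (use dec in \<open>auto simp: carrier\<close>)
  have card_F: "card ?F = n" using card_image[OF dec(2)] by simp
  \<comment> \<open>\<open>q m\<close> is the number of nonzero residues whose order is incomparable
    with \<open>m\<close>.\<close>
  define q where "q m = (\<Sum>k | k dvd n \<and> k \<noteq> 1 \<and> \<not> (k dvd m \<or> m dvd k). totient k)" for m
  let ?D = "{k. k dvd n \<and> k \<noteq> 1 \<and> k \<noteq> n}"
  have "(\<Sum>a\<in>verts ?K - {0}. 1 + card ?F
      + card {x \<in> verts ?K - {0}. x \<noteq> a \<and> {x, a} \<notin> edges ?K})
      = (\<Sum>a\<in>?A. n + 1 + q (cyclic_order n a))"
    unfolding A
  proof (rule sum.cong)
    fix a assume a: "a \<in> ?A"
    show "1 + card ?F + card {x \<in> ?A. x \<noteq> a \<and> {x, a} \<notin> edges ?K} = n + 1 + q (cyclic_order n a)"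
      unfolding card_incomparable_cyclic_order[OF n a] card_F q_def by simp
  qed simp
  also have "\<dots> = (\<Sum>k | k dvd n \<and> k \<noteq> 1. (n + 1 + q k) * totient k)"
    by (rule sum_cyclic_order[OF n, of "\<lambda>k. n + 1 + q k"])
  \<comment> \<open>The generators, of order \<open>n\<close>, are separated from the residues whose
    order is a proper divisor.\<close>
  also have "\<dots> = (\<Sum>k\<in>insert n ?D. (n + 1 + q k) * totient k)"
    using assms(1) by (intro sum.cong) auto
  also have "\<dots> = (n + 1 + q n) * totient n + (\<Sum>k\<in>?D. (n + 1 + q k) * totient k)"
    using n by (intro sum.insert) auto
  finally have sum_A: "(\<Sum>a\<in>verts ?K - {0}. 1 + card ?F
      + card {x \<in> verts ?K - {0}. x \<noteq> a \<and> {x, a} \<notin> edges ?K})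
      = (n + 1 + q n) * totient n + (\<Sum>k\<in>?D. (n + 1 + q k) * totient k)" .
  \<comment> \<open>Every divisor is comparable with \<open>n\<close>, so the generators contribute
    \<open>(n + 1) * totient n\<close>, which supplies both occurrences of \<open>totient n\<close>
    in the closed terms of the formula.\<close>
  have q_n: "q n = 0" unfolding q_def by (rule sum.neutral) auto
  have "(\<Sum>k\<in>?D. (n + 1 + q k) * totient k) =
      (\<Sum>i = 1..D. (n + 1 + q (d i)) * totient (d i))"
    unfolding assms(3)[symmetric]
    using strict_mono_on_imp_inj_on[OF assms(2)] by (simp add: sum.reindex)
  also have "\<dots> = (\<Sum>i = 1..D. (n + 1
      + (\<Sum>k | k \<in> {1..D} \<and> k \<noteq> i \<and> \<not> (d k dvd d i \<or> d i dvd d k). totient (d k)))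
      * totient (d i))"
  proof (rule sum.cong)
    fix i assume i: "i \<in> {1..D}"
    let ?I = "{k. k \<in> {1..D} \<and> k \<noteq> i \<and> \<not> (d k dvd d i \<or> d i dvd d k)}"
    have "d i \<in> ?D" using i assms(3) by blast
    \<comment> \<open>The divisor \<open>n\<close> drops out because \<open>d i\<close> divides it.
      In the indexed sum, \<open>k \<noteq> i\<close> already follows from incomparability.\<close>
    then have "{k. k dvd n \<and> k \<noteq> 1 \<and> \<not> (k dvd d i \<or> d i dvd k)} =
        {k \<in> ?D. \<not> (k dvd d i \<or> d i dvd k)}" by auto
    also have "\<dots> = d ` ?I" unfolding assms(3)[symmetric] by auto
    finally have "q (d i) = sum totient (d ` ?I)" unfolding q_def by simp
    also have "\<dots> = (\<Sum>k\<in>?I. totient (d k))"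
      by (rule sum.reindex_cong[OF inj_on_subset[OF strict_mono_on_imp_inj_on[OF assms(2)]]]) auto
    finally show "(n + 1 + q (d i)) * totient (d i) =
        (n + 1 + (\<Sum>k\<in>?I. totient (d k))) * totient (d i)" by simp
  qed simp
  finally have sum_D: "(\<Sum>k\<in>?D. (n + 1 + q k) * totient k) = (\<Sum>i = 1..D. (n + 1
      + (\<Sum>k | k \<in> {1..D} \<and> k \<noteq> i \<and> \<not> (d k dvd d i \<or> d i dvd d k). totient (d k)))
      * totient (d i))" .
  have "card (verts ?K) = n" by (simp add: carrier)
  then have "card ?F * (card (verts ?K) + card ?F - 1) = n * (2 * n - 1)"
    unfolding card_F by (simp add: mult_2)
  then show ?thesis
    unfolding szeged_index_pendant_extension sum_A
    unfolding sum_D q_n by (simp add: add_mult_distrib add_mult_distrib2)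
qed

end
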